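(* Let $X$ be a Hausdorff space, $\lambda$ a regular content on $X$ and $X^\lambda$ the associated Boolean inner measure locale. Then the natural map $p_\lambda:X^\lambda\rightarrow X$ induces an injection $$\mathrm{pts}(X^\lambda)\hookrightarrow\mathrm{pts}(X)$$ which identifies the left-hand side with the set of points $x$ of $X$ such that $\lambda(\{x\})>0$.
   Context: A frame is a poset with arbitrary suprema and finite infima satisfying $V\wedge\bigvee_i U_i=\bigvee_i(V\wedge U_i)$; locales are the objects of the opposite category of frames, $\mathcal{O}(L)$ is the frame of $L$, and a continuous map $f:L\to M$ is a frame homomorphism $f^*:\mathcal{O}(M)\to\mathcal{O}(L)$. Hausdorff spaces are identified with the locales of their frames of opens. $\mathrm{pts}(L)$ is the set of continuous maps from the one-point locale to $L$ (equivalently completely prime filters of $\mathcal{O}(L)$); for a Hausdorff space $X$, $\mathrm{pts}(X)$ is the underlying set of $X$. $\mathcal{K}(X)$ is the lattice of compact subsets of $X$. A content is a function $\lambda:\mathcal{K}(X)\to[0,+\infty)$ that is monotone, subadditive ($\lambda(C\cup D)\le\lambda(C)+\lambda(D)$), and additive on disjoint pairs. Write $K_1\ll K_2$ if there is an open $U$ with $K_1\subset U\subset K_2$. A content is regular if $\lambda(K)=\inf\{\lambda(K')\mid K\ll K',\ K'\text{ compact}\}$ for all compact $K$ (infimum in $[0,+\infty]$). On a Hausdorff space a regular content is modular: $\lambda(C)+\lambda(D)=\lambda(C\cup D)+\lambda(C\cap D)$. A $\lambda$-ideal is a downward closed $U\subset\mathcal{K}(X)$ such that $K\in U$ whenever there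 are $K_i\in U$ $(i\in I)$, $K_i\subset K$, such that for all $\epsilon>0$ some finite $F\subset I$ has $\lambda(K)-\lambda(\bigcup_{i\in F}K_i)<\epsilon$. The $\lambda$-ideals ordered by inclusion form the frame of a locale $X^\lambda$, which is Boolean (every open has a complement). The map $p_\lambda:X^\lambda\to X$ has inverse image sending an open $V\subset X$ to the smallest $\lambda$-ideal containing $\{K\subset V\mid K\text{ compact}\}$. *)

theory Defs
  imports "HOL-Analysis.Analysis" "HOL-Algebra.Complete_Lattice"
begin

section \<open>Frames and locales\<close>

locale frame = complete_lattice L for L (structure) +
  assumes meet_Sup_distrib:
    "\<lbrakk>V \<in> carrier L; A \<subseteq> carrier L\<rbrakk> \<Longrightarrow> V \<sqinter> (\<Squnion>A) = \<Squnion>((\<lambda>U. V \<sqinter> U) ` A)"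

text \<open>Homomorphisms are taken extensional, so that two of them are equal as soon as they agree
  on the carrier.\<close>

definition frame_homs :: "'a gorder \<Rightarrow> 'b gorder \<Rightarrow> ('a \<Rightarrow> 'b) set" where
  "frame_homs M L = {f. frame M \<and> frame L \<and> f \<in> carrier M \<rightarrow>\<^sub>E carrier L \<and>
     (\<forall>A. A \<subseteq> carrier M \<longrightarrow> f (\<Squnion>\<^bsub>M\<^esub>A) = \<Squnion>\<^bsub>L\<^esub>(f ` A)) \<and>
     f \<top>\<^bsub>M\<^esub> = \<top>\<^bsub>L\<^esub> \<and>
     (\<forall>U\<in>carrier M. \<forall>V\<in>carrier M. f (U \<sqinter>\<^bsub>M\<^esub> V) = f U \<sqinter>\<^bsub>L\<^esub> f V)}"

text \<open>A locale is represented by its frame of opens, and a continuous map of locales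
  $f : L \to M$ by its inverse image $f^*$, which goes from the frame of $M$ to that of $L$.\<close>

definition continuous_locale_maps :: "'a gorder \<Rightarrow> 'b gorder \<Rightarrow> ('b \<Rightarrow> 'a) set" where
  "continuous_locale_maps L M = frame_homs M L"

text \<open>Inverse image of $g \circ f$, where \<open>g\<close> is a map to the locale \<open>M\<close>.\<close>

definition locale_comp :: "'c gorder \<Rightarrow> ('c \<Rightarrow> 'b) \<Rightarrow> ('b \<Rightarrow> 'a) \<Rightarrow> 'c \<Rightarrow> 'a" where
  "locale_comp M g f = compose (carrier M) f g"

definition open_locale :: "'a topology \<Rightarrow> 'a set gorder" where
  "open_locale X = \<lparr>carrier = {U. openin X U}, eq = (=), le = (\<subseteq>)\<rparr>"

definition locale_map_of :: "'a topology \<Rightarrow> 'b topology \<Rightarrow> ('a \<Rightarrow> 'b) \<Rightarrow> 'b set \<Rightarrow> 'a set" where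
  "locale_map_of X Y f = (\<lambda>V\<in>carrier (open_locale Y). {x \<in> topspace X. f x \<in> V})"

abbreviation one_point_space :: "unit topology" where
  "one_point_space \<equiv> discrete_topology UNIV"

definition pts :: "'a gorder \<Rightarrow> ('a \<Rightarrow> unit set) set" where
  "pts L = continuous_locale_maps (open_locale one_point_space) L"

text \<open>For a continuous map $f : L \to M$ this is the induced map
  $\mathrm{pts}(L) \to \mathrm{pts}(M)$, $x \mapsto f \circ x$.\<close>

definition pts_map :: "'b gorder \<Rightarrow> ('b \<Rightarrow> 'a) \<Rightarrow> ('a \<Rightarrow> unit set) \<Rightarrow> 'b \<Rightarrow> unit set" where
  "pts_map M f x = locale_comp M f x"

text \<open>The identification of the underlying set of a Hausdorff space \<open>X\<close> with the points of its
  locale: \<open>x\<close> corresponds to the continuous map from the one-point space with value \<open>x\<close>.\<close>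

definition space_point :: "'a topology \<Rightarrow> 'a \<Rightarrow> 'a set \<Rightarrow> unit set" where
  "space_point X x = locale_map_of one_point_space X (\<lambda>_. x)"

section \<open>Contents\<close>

text \<open>A content is a function on compact subsets; values of \<open>l\<close> on other sets are irrelevant.\<close>

definition is_content :: "'a topology \<Rightarrow> ('a set \<Rightarrow> real) \<Rightarrow> bool" where
  "is_content X l \<longleftrightarrow>
     (\<forall>C. compactin X C \<longrightarrow> 0 \<le> l C) \<and>
     (\<forall>C D. compactin X C \<longrightarrow> compactin X D \<longrightarrow> C \<subseteq> D \<longrightarrow> l C \<le> l D) \<and>
     (\<forall>C D. compactin X C \<longrightarrow> compactin X D \<longrightarrow> l (C \<union> D) \<le> l C + l D) \<and>
     (\<forall>C D. compactin X C \<longrightarrow> compactin X D \<longrightarrow> C \<inter> D = {} \<longrightarrow> l (C \<union> D) = l C + l D)"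

definition well_inside :: "'a topology \<Rightarrow> 'a set \<Rightarrow> 'a set \<Rightarrow> bool" where
  "well_inside X C D \<longleftrightarrow> (\<exists>U. openin X U \<and> C \<subseteq> U \<and> U \<subseteq> D)"

text \<open>The infimum is taken in the extended reals: it is $+\infty$ if \<open>K\<close> has no compact
  neighbourhood, so regularity excludes that case.\<close>

definition regular_content :: "'a topology \<Rightarrow> ('a set \<Rightarrow> real) \<Rightarrow> bool" where
  "regular_content X l \<longleftrightarrow> is_content X l \<and>
     (\<forall>K. compactin X K \<longrightarrow>
        ereal (l K) = (INF K' \<in> {K'. compactin X K' \<and> well_inside X K K'}. ereal (l K')))"

section \<open>The inner measure locale\<close>

text \<open>The families $(K_i)_{i \in I}$ are represented by the sets \<open>S\<close> of their members. The empty
  family is allowed, so every compact set of content zero belongs to every ideal.\<close>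

definition content_ideal :: "'a topology \<Rightarrow> ('a set \<Rightarrow> real) \<Rightarrow> 'a set set \<Rightarrow> bool" where
  "content_ideal X l J \<longleftrightarrow>
     J \<subseteq> {K. compactin X K} \<and>
     (\<forall>K\<in>J. \<forall>K'. compactin X K' \<longrightarrow> K' \<subseteq> K \<longrightarrow> K' \<in> J) \<and>
     (\<forall>K S. compactin X K \<longrightarrow> S \<subseteq> J \<longrightarrow> (\<forall>K'\<in>S. K' \<subseteq> K) \<longrightarrow>
        (\<forall>\<epsilon>>0. \<exists>F. finite F \<and> F \<subseteq> S \<and> l K - l (\<Union>F) < \<epsilon>) \<longrightarrow> K \<in> J)"

definition measure_locale :: "'a topology \<Rightarrow> ('a set \<Rightarrow> real) \<Rightarrow> 'a set set gorder" where
  "measure_locale X l = \<lparr>carrier = {J. content_ideal X l J}, eq = (=), le = (\<subseteq>)\<rparr>"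

text \<open>The inverse image of the natural map from the measure locale to \<open>X\<close>.\<close>

definition measure_proj :: "'a topology \<Rightarrow> ('a set \<Rightarrow> real) \<Rightarrow> 'a set \<Rightarrow> 'a set set" where
  "measure_proj X l =
     (\<lambda>V\<in>carrier (open_locale X). content_ideal X l hull {K. compactin X K \<and> K \<subseteq> V})"

end

theory Submission
  imports Defs
begin

text \<open>
  A point of a locale is a frame homomorphism to the two-element frame, and such a homomorphism is
  determined by the largest open that it kills. For the opens of a Hausdorff space this largest
  open is the complement of a single point, since two distinct points outside it would have
  disjoint neighbourhoods of which neither is killed. So once the map $p_\lambda$ is known to be
  continuous, every point $p$ of $X^\lambda$ lies over a unique $x \in X$.

  Let $W$ be the largest $\lambda$-ideal killed by such a $p$. The complement of $x$ is killed, so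
  $W$ contains every compact set that misses $x$. If it also contained $\{x\}$, it would contain
  every compact $K$: for small open $U \ni x$ the set $(K \setminus U) \cup \{x\}$ exhausts $K$ up
  to $\epsilon$ by regularity at $\{x\}$, and then $p$ would kill everything. So $\{x\} \notin W$. Since
  sets of content zero lie in every ideal, $\lambda(\{x\}) > 0$; and $W$ consists exactly of the
  compact sets missing $x$, so $p$ is determined by $x$ (\<open>point_over_space_point\<close>). Conversely, if
  $\lambda(\{x\}) > 0$, then a compact set containing $x$ cannot be exhausted by compact sets that
  miss $x$, so the latter form an ideal and $J \mapsto [\{x\} \in J]$ is a point of $X^\lambda$ above $x$
  (\<open>atom_point_in_pts\<close>, \<open>pts_map_atom_point\<close>).

  It remains to see that the $\lambda$-ideals form a frame and that $p_\lambda^*$ is a frame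
  homomorphism. Both distributivity and the preservation of finite meets come from
  \<open>generated_Int\<close>: generating an ideal commutes with binary intersections of downward closed
  families of compact sets. That rests on one half of modularity, $\lambda(C) + \lambda(D) \le \lambda(C \cup D) +
  \lambda(C \cap D)$, by which the defect of an exhaustion does not grow when it is restricted to
  a smaller compact set. Preservation of joins uses that regularity of the content forces $X$ to be
  locally compact.
\<close>

section \<open>Frames of sets\<close>

text \<open>Opens of a space and $\lambda$-ideals are both ordered by inclusion with intersections as binary
  meets, and differ only in their joins; \<open>lub\<close> is the join, and \<open>lub C\<close> is the top element.\<close>

locale frame_of_sets =
  fixes C :: "'a set set" and lub :: "'a set set \<Rightarrow> 'a set"
  assumes lub_mem: "A \<subseteq> C \<Longrightarrow> lub A \<in> C"
    and lub_upper: "A \<subseteq> C \<Longrightarrow> U \<in> A \<Longrightarrow> U \<subseteq> lub A"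
    and lub_least: "A \<subseteq> C \<Longrightarrow> V \<in> C \<Longrightarrow> (\<And>U. U \<in> A \<Longrightarrow> U \<subseteq> V) \<Longrightarrow> lub A \<subseteq> V"
    and Int_mem: "U \<in> C \<Longrightarrow> V \<in> C \<Longrightarrow> U \<inter> V \<in> C"
    and Int_lub_subset: "V \<in> C \<Longrightarrow> A \<subseteq> C \<Longrightarrow> V \<inter> lub A \<subseteq> lub ((\<inter>) V ` A)"
begin

abbreviation L :: "'a set gorder" where
  "L \<equiv> \<lparr>carrier = C, eq = (=), le = (\<subseteq>)\<rparr>"

lemma least_Upper_iff:
  assumes A: "A \<subseteq> C"
  shows "least L T (Upper L A) \<longleftrightarrow> T = lub A"
proof -
  have "Upper L A = {T \<in> C. \<forall>U\<in>A. U \<subseteq> T}"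
    using A by (auto simp: Upper_def)
  then have "least L T (Upper L A) \<longleftrightarrow>
      T \<in> C \<and> (\<forall>U\<in>A. U \<subseteq> T) \<and> (\<forall>T'\<in>C. (\<forall>U\<in>A. U \<subseteq> T') \<longrightarrow> T \<subseteq> T')"
    by (simp add: least_def) blast
  also have "\<dots> \<longleftrightarrow> T = lub A"
    using lub_mem[OF A] lub_upper[OF A] lub_least[OF A] by (metis subset_antisym)
  finally show ?thesis .
qed

lemma greatest_Lower_pair_iff:
  assumes "U \<in> C" "V \<in> C"
  shows "greatest L T (Lower L {U, V}) \<longleftrightarrow> T = U \<inter> V"
proof -
  have "Lower L {U, V} = {T \<in> C. T \<subseteq> U \<inter> V}"
    using assms by (auto simp: Lower_def)
  then have "greatest L T (Lower L {U, V}) \<longleftrightarrow>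
      T \<in> C \<and> T \<subseteq> U \<inter> V \<and> (\<forall>T'\<in>C. T' \<subseteq> U \<inter> V \<longrightarrow> T' \<subseteq> T)"
    by (simp add: greatest_def) blast
  also have "\<dots> \<longleftrightarrow> T = U \<inter> V"
    using Int_mem[OF assms] by (metis subset_antisym subset_refl)
  finally show ?thesis .
qed

lemma greatest_carrier_iff: "greatest L T C \<longleftrightarrow> T = lub C"
  using lub_mem[of C] lub_upper[of C] unfolding greatest_def
  by (simp, metis subset_antisym)

lemma Sup_eq: "A \<subseteq> C \<Longrightarrow> \<Squnion>\<^bsub>L\<^esub>A = lub A"
  by (simp add: Lattice.sup_def least_Upper_iff)

lemma meet_eq: "U \<in> C \<Longrightarrow> V \<in> C \<Longrightarrow> U \<sqinter>\<^bsub>L\<^esub> V = U \<inter> V"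
  by (simp add: Lattice.meet_def Lattice.inf_def greatest_Lower_pair_iff)

lemma top_eq: "\<top>\<^bsub>L\<^esub> = lub C"
  by (simp add: Order.top_def greatest_carrier_iff)

lemma frame: "frame L"
proof -
  interpret partial_order L
    by unfold_locales simp_all
  \<comment> \<open>Infinite meets are not intersections in general: they are joins of lower bounds.\<close>
  have inf: "\<exists>T. greatest L T (Lower L A)" if A: "A \<subseteq> C" for A
  proof
    let ?B = "{U \<in> C. \<forall>V\<in>A. U \<subseteq> V}"
    have B: "?B \<subseteq> C"
      by auto
    have low: "Lower L A = ?B"
      using A by (auto simp: Lower_def)
    have "lub ?B \<subseteq> V" if "V \<in> A" for V
      using that A by (intro lub_least B) auto
    moreover have "U \<subseteq> lub ?B" if "U \<in> ?B" for U
      using lub_upper[OF B that] .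
    ultimately show "greatest L (lub ?B) (Lower L A)"
      using lub_mem[OF B] unfolding greatest_def low by simp
  qed
  interpret complete_lattice L
  proof
    show "\<exists>T. least L T (Upper L A)" if "A \<subseteq> carrier L" for A
      using that by (simp add: least_Upper_iff)
    show "\<exists>T. greatest L T (Lower L A)" if "A \<subseteq> carrier L" for A
      using that inf by simp
  qed
  have "V \<inter> lub A = lub ((\<inter>) V ` A)" if V: "V \<in> C" and A: "A \<subseteq> C" for V A
  proof
    have "V \<inter> U \<subseteq> V \<inter> lub A" if "U \<in> A" for U
      using lub_upper[OF A that] by blast
    moreover have "(\<inter>) V ` A \<subseteq> C"
      using V A Int_mem by blast
    ultimately show "lub ((\<inter>) V ` A) \<subseteq> V \<inter> lub A"
      by (intro lub_least Int_mem V lub_mem A) auto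
  qed (rule Int_lub_subset[OF V A])
  moreover have "(\<lambda>U. V \<sqinter>\<^bsub>L\<^esub> U) ` A = (\<inter>) V ` A" if "V \<in> C" "A \<subseteq> C" for V A
    using that by (intro image_cong) (auto simp: meet_eq)
  moreover have "(\<inter>) V ` A \<subseteq> C" if "V \<in> C" "A \<subseteq> C" for V A
    using that Int_mem by auto
  ultimately show ?thesis
    by unfold_locales (simp add: meet_eq lub_mem Sup_eq)
qed

end

lemma frame_of_sets_open: "frame_of_sets {U. openin X U} Union"
  by unfold_locales auto

lemmas open_locale_Sup = frame_of_sets.Sup_eq[OF frame_of_sets_open, folded open_locale_def]
lemmas open_locale_meet = frame_of_sets.meet_eq[OF frame_of_sets_open, folded open_locale_def]
lemmas open_locale_top = frame_of_sets.top_eq[OF frame_of_sets_open, folded open_locale_def]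
lemmas open_locale_frame = frame_of_sets.frame[OF frame_of_sets_open, folded open_locale_def]

lemma carrier_open_locale: "carrier (open_locale X) = {U. openin X U}"
  by (simp add: open_locale_def)

lemma (in frame_of_sets) mem_pts_iff:
  "q \<in> pts L \<longleftrightarrow> q \<in> extensional C \<and> q (lub C) = UNIV \<and>
     (\<forall>A. A \<subseteq> C \<longrightarrow> q (lub A) = \<Union>(q ` A)) \<and> (\<forall>U\<in>C. \<forall>V\<in>C. q (U \<inter> V) = q U \<inter> q V)"
proof -
  have "\<top>\<^bsub>open_locale one_point_space\<^esub> = (UNIV :: unit set)"
    by (auto simp: open_locale_top)
  moreover have "\<Squnion>\<^bsub>open_locale one_point_space\<^esub>B = \<Union>B" for B :: "unit set set"
    by (simp add: open_locale_Sup)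
  moreover have "U \<sqinter>\<^bsub>open_locale one_point_space\<^esub> V = U \<inter> V" for U V :: "unit set"
    by (simp add: open_locale_meet)
  ultimately show ?thesis
    by (auto simp: pts_def continuous_locale_maps_def frame_homs_def frame open_locale_frame
        carrier_open_locale PiE_iff Sup_eq meet_eq top_eq)
qed

text \<open>A homomorphism to the two-element frame preserves joins, so it kills the join of all the elements
  it kills, and this join determines it.\<close>

lemma (in frame_of_sets) point_kernel:
  assumes "q \<in> pts L"
  obtains W where "W \<in> C" "\<not> lub C \<subseteq> W" "\<And>U. U \<in> C \<Longrightarrow> q U = (if U \<subseteq> W then {} else UNIV)"
proof
  let ?Z = "{U \<in> C. q U = {}}"
  have q: "q (lub C) = UNIV" "\<And>A. A \<subseteq> C \<Longrightarrow> q (lub A) = \<Union>(q ` A)"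
    "\<And>U V. U \<in> C \<Longrightarrow> V \<in> C \<Longrightarrow> q (U \<inter> V) = q U \<inter> q V"
    using assms by (auto simp: mem_pts_iff)
  show W: "lub ?Z \<in> C"
    by (rule lub_mem) auto
  have null: "q (lub ?Z) = {}"
    using q(2)[of ?Z] by auto
  have iff: "q U = {} \<longleftrightarrow> U \<subseteq> lub ?Z" if "U \<in> C" for U
  proof
    assume "q U = {}"
    then show "U \<subseteq> lub ?Z"
      using that by (intro lub_upper) auto
  next
    assume "U \<subseteq> lub ?Z"
    then have "q U = q U \<inter> q (lub ?Z)"
      using q(3)[OF that W] by (simp add: Int_absorb2)
    then show "q U = {}"
      using null by simp
  qed
  show "\<not> lub C \<subseteq> lub ?Z"
    using iff[of "lub C"] lub_mem[of C] q(1) by auto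
  show "q U = (if U \<subseteq> lub ?Z then {} else UNIV)" if "U \<in> C" for U
    using iff[OF that] by (auto simp: UNIV_unit)
qed

lemma space_point_eq: "space_point X x = (\<lambda>V\<in>{V. openin X V}. if x \<in> V then UNIV else {})"
  by (auto simp: space_point_def locale_map_of_def carrier_open_locale fun_eq_iff)

text \<open>Two distinct points outside the largest killed open would have disjoint neighbourhoods, of which one
  is killed because their intersection is.\<close>

lemma Hausdorff_imp_sober:
  assumes "Hausdorff_space X" "q \<in> pts (open_locale X)"
  obtains x where "x \<in> topspace X" "q = space_point X x"
proof -
  interpret frame_of_sets "{U. openin X U}" Union
    by (rule frame_of_sets_open)
  obtain W where W: "openin X W" "\<not> \<Union>{U. openin X U} \<subseteq> W"
    and q: "\<And>U. openin X U \<Longrightarrow> q U = (if U \<subseteq> W then {} else UNIV)"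
    using point_kernel[OF assms(2)[unfolded open_locale_def]] by auto
  have ext: "q \<in> extensional {U. openin X U}"
    and qInt: "\<And>U V. openin X U \<Longrightarrow> openin X V \<Longrightarrow> q (U \<inter> V) = q U \<inter> q V"
    using assms(2) by (auto simp: mem_pts_iff open_locale_def)
  obtain x where x: "x \<in> topspace X" "x \<notin> W"
    using W openin_subset by fastforce
  have "y = x" if y: "y \<in> topspace X" "y \<notin> W" for y
  proof (rule ccontr)
    assume "y \<noteq> x"
    then obtain U V where UV: "openin X U" "openin X V" "x \<in> U" "y \<in> V" "disjnt U V"
      using assms(1) x y unfolding Hausdorff_space_def by metis
    then have "q U \<inter> q V = q {}"
      using qInt[of U V] by (simp add: disjnt_def)
    then show False
      using UV q[of U] q[of V] q[of "{}"] x y by (auto split: if_splits)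
  qed
  then have "U \<subseteq> W \<longleftrightarrow> x \<notin> U" if "openin X U" for U
    using x that openin_subset by blast
  then have "q = space_point X x"
    using ext by (intro extensionalityI) (auto simp: space_point_eq q)
  with x show thesis
    using that by blast
qed

lemma frame_homs_compose:
  assumes f: "f \<in> frame_homs M L" and g: "g \<in> frame_homs L N"
  shows "compose (carrier M) g f \<in> frame_homs M N"
proof -
  interpret M: frame M
    using f by (simp add: frame_homs_def)
  have f_mem: "f U \<in> carrier L" if "U \<in> carrier M" for U
    using f that by (auto simp: frame_homs_def)
  have "compose (carrier M) g f (\<Squnion>\<^bsub>M\<^esub>A) = \<Squnion>\<^bsub>N\<^esub>(compose (carrier M) g f ` A)"
    if A: "A \<subseteq> carrier M" for A
  proof -
    have "g (f (\<Squnion>\<^bsub>M\<^esub>A)) = g (\<Squnion>\<^bsub>L\<^esub>(f ` A))"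
      using f A by (simp add: frame_homs_def)
    also have "\<dots> = \<Squnion>\<^bsub>N\<^esub>(g ` f ` A)"
    proof -
      have "f ` A \<subseteq> carrier L"
        using A f_mem by auto
      then show ?thesis
        using g by (simp add: frame_homs_def)
    qed
    also have "g ` f ` A = compose (carrier M) g f ` A"
      unfolding image_image using A by (intro image_cong refl) (auto simp: compose_eq)
    finally show ?thesis
      using A by (simp add: compose_eq)
  qed
  moreover have "compose (carrier M) g f (U \<sqinter>\<^bsub>M\<^esub> V) = compose (carrier M) g f U \<sqinter>\<^bsub>N\<^esub> compose (carrier M) g f V"
    if "U \<in> carrier M" "V \<in> carrier M" for U V
    using that f g f_mem by (simp add: frame_homs_def compose_eq)
  moreover have "compose (carrier M) g f \<in> carrier M \<rightarrow>\<^sub>E carrier N"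
    using g f_mem by (auto simp: frame_homs_def compose_eq compose_def)
  moreover have "compose (carrier M) g f \<top>\<^bsub>M\<^esub> = \<top>\<^bsub>N\<^esub>"
    using f g by (simp add: frame_homs_def compose_eq)
  ultimately show ?thesis
    using f g by (simp add: frame_homs_def)
qed

lemma pts_map_in_pts:
  "f \<in> continuous_locale_maps L M \<Longrightarrow> x \<in> pts L \<Longrightarrow> pts_map M f x \<in> pts M"
  by (simp add: pts_def continuous_locale_maps_def pts_map_def locale_comp_def frame_homs_compose)

section \<open>Regular contents\<close>

locale regular_content_space =
  fixes X :: "'a topology" and l :: "'a set \<Rightarrow> real"
  assumes Hausdorff: "Hausdorff_space X"
    and regular: "regular_content X l"
begin

lemma content_nonneg: "compactin X C \<Longrightarrow> 0 \<le> l C"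
  and content_mono: "compactin X C \<Longrightarrow> compactin X D \<Longrightarrow> C \<subseteq> D \<Longrightarrow> l C \<le> l D"
  and content_Un_le: "compactin X C \<Longrightarrow> compactin X D \<Longrightarrow> l (C \<union> D) \<le> l C + l D"
  and content_Un_disjoint:
    "compactin X C \<Longrightarrow> compactin X D \<Longrightarrow> C \<inter> D = {} \<Longrightarrow> l (C \<union> D) = l C + l D"
  using regular by (auto simp: regular_content_def is_content_def)

lemma content_empty: "l {} = 0"
  using content_Un_disjoint[of "{}" "{}"] by simp

lemma compactin_Int: "compactin X C \<Longrightarrow> compactin X D \<Longrightarrow> compactin X (C \<inter> D)"
  by (simp add: Hausdorff compact_Int_closedin compactin_imp_closedin)

lemma compactin_Diff:
  assumes "compactin X C" "openin X U"
  shows "compactin X (C - U)"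
proof -
  have "C - U = C \<inter> (topspace X - U)"
    using compactin_subset_topspace[OF assms(1)] by blast
  then show ?thesis
    using assms by (simp add: compact_Int_closedin openin_closedin_eq)
qed

text \<open>Regularity of the content in the form in which it is applied; since the value of the infimum is
  finite, it also provides the compact neighbourhood.\<close>

lemma compact_neighbourhood_approx:
  assumes "compactin X K" "0 < e"
  obtains U N where "openin X U" "compactin X N" "K \<subseteq> U" "U \<subseteq> N" "l N < l K + e"
proof -
  have "(INF K' \<in> {K'. compactin X K' \<and> well_inside X K K'}. ereal (l K')) < ereal (l K + e)"
    using regular assms unfolding regular_content_def
    by (metis ereal_less_le less_add_same_cancel1 less_ereal.simps(1))
  then show thesis
    using that by (auto simp: INF_less_iff well_inside_def)
qed

lemma locally_compact: "locally_compact_space X"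
  unfolding locally_compact_space_def
proof
  fix x assume "x \<in> topspace X"
  then obtain U N where "openin X U" "compactin X N" "{x} \<subseteq> U" "U \<subseteq> N"
    using compact_neighbourhood_approx[of "{x}" 1] by (metis compactin_sing zero_less_one)
  then show "\<exists>U K. openin X U \<and> compactin X K \<and> x \<in> U \<and> U \<subseteq> K"
    by blast
qed

text \<open>Thicken \<open>C \<inter> D\<close> to a compact neighbourhood \<open>N\<close> of almost the same content. Cutting its interior
  out of \<open>C\<close> costs \<open>C\<close> at most the content of \<open>N\<close>, and what remains of \<open>C\<close> is disjoint from \<open>D\<close>, so
  additivity applies to it.\<close>

lemma content_supermodular:
  assumes "compactin X C" "compactin X D"
  shows "l C + l D \<le> l (C \<union> D) + l (C \<inter> D)"
proof (rule field_le_epsilon)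
  fix e :: real assume "0 < e"
  then obtain U N where UN: "openin X U" "compactin X N" "C \<inter> D \<subseteq> U" "U \<subseteq> N" "l N < l (C \<inter> D) + e"
    using compact_neighbourhood_approx[OF compactin_Int[OF assms]] by blast
  have CU: "compactin X (C - U)"
    using assms UN by (simp add: compactin_Diff)
  have "l C \<le> l ((C - U) \<union> N)"
    using assms UN CU by (intro content_mono) (auto simp: compactin_Un)
  also have "\<dots> \<le> l (C - U) + l N"
    using UN CU by (intro content_Un_le)
  finally have "l C \<le> l (C - U) + l N" .
  moreover have "l (C - U) + l D = l ((C - U) \<union> D)"
    using UN by (intro content_Un_disjoint[symmetric] CU assms) auto
  moreover have "l ((C - U) \<union> D) \<le> l (C \<union> D)"
    using assms CU by (intro content_mono) (auto simp: compactin_Un)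
  ultimately show "l C + l D \<le> l (C \<union> D) + l (C \<inter> D) + e"
    using UN by linarith
qed

text \<open>If \<open>D\<close> fills \<open>K\<close> up to \<open>\<epsilon>\<close>, then it fills every compact subset of \<open>K\<close> up to \<open>\<epsilon>\<close>; this makes
  exhaustions restrict to smaller compact sets.\<close>

lemma content_deficit_Int_le:
  assumes "compactin X K" "compactin X C" "compactin X D" "C \<subseteq> K" "D \<subseteq> K"
  shows "l C - l (C \<inter> D) \<le> l K - l D"
proof -
  have "l (C \<union> D) \<le> l K"
    using assms by (intro content_mono compactin_Un) auto
  then show ?thesis
    using content_supermodular[OF assms(2,3)] by linarith
qed

section \<open>Ideals of compact sets\<close>

abbreviation generated :: "'a set set \<Rightarrow> 'a set set" where
  "generated A \<equiv> content_ideal X l hull A"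

definition down_closed :: "'a set set \<Rightarrow> bool" where
  "down_closed A \<longleftrightarrow> A \<subseteq> {K. compactin X K} \<and> (\<forall>K\<in>A. \<forall>K'. compactin X K' \<longrightarrow> K' \<subseteq> K \<longrightarrow> K' \<in> A)"

lemma down_closed_ideal: "content_ideal X l J \<Longrightarrow> down_closed J"
  by (simp add: content_ideal_def down_closed_def)

lemma down_closed_Union: "(\<And>A. A \<in> S \<Longrightarrow> down_closed A) \<Longrightarrow> down_closed (\<Union>S)"
  unfolding down_closed_def by blast

lemma down_closed_open: "down_closed {K. compactin X K \<and> K \<subseteq> V}"
  unfolding down_closed_def by blast

lemma content_idealI:
  assumes "\<And>K. K \<in> J \<Longrightarrow> compactin X K"
    and "\<And>K K'. K \<in> J \<Longrightarrow> compactin X K' \<Longrightarrow> K' \<subseteq> K \<Longrightarrow> K' \<in> J"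
    and "\<And>K S. compactin X K \<Longrightarrow> S \<subseteq> J \<Longrightarrow> (\<And>K'. K' \<in> S \<Longrightarrow> K' \<subseteq> K) \<Longrightarrow>
      (\<And>e. 0 < e \<Longrightarrow> \<exists>F. finite F \<and> F \<subseteq> S \<and> l K - l (\<Union>F) < e) \<Longrightarrow> K \<in> J"
  shows "content_ideal X l J"
  unfolding content_ideal_def
proof (intro conjI allI impI ballI)
  show "J \<subseteq> {K. compactin X K}"
    using assms(1) by blast
  show "K' \<in> J" if "K \<in> J" "compactin X K'" "K' \<subseteq> K" for K K'
    using assms(2) that .
  show "K \<in> J" if "compactin X K" "S \<subseteq> J" "\<forall>K'\<in>S. K' \<subseteq> K"
    "\<forall>e>0. \<exists>F. finite F \<and> F \<subseteq> S \<and> l K - l (\<Union>F) < e" for K S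
    using assms(3)[of K S] that by simp
qed

lemma ideal_compactin: "content_ideal X l J \<Longrightarrow> K \<in> J \<Longrightarrow> compactin X K"
  using down_closed_ideal by (auto simp: down_closed_def)

lemma ideal_down: "content_ideal X l J \<Longrightarrow> K \<in> J \<Longrightarrow> compactin X K' \<Longrightarrow> K' \<subseteq> K \<Longrightarrow> K' \<in> J"
  using down_closed_ideal unfolding down_closed_def by blast

lemma ideal_exhaust:
  assumes "content_ideal X l J" "compactin X K" "S \<subseteq> J" "\<And>K'. K' \<in> S \<Longrightarrow> K' \<subseteq> K"
    and "\<And>e. 0 < e \<Longrightarrow> \<exists>F. finite F \<and> F \<subseteq> S \<and> l K - l (\<Union>F) < e"
  shows "K \<in> J"
proof -
  have "\<forall>K S. compactin X K \<longrightarrow> S \<subseteq> J \<longrightarrow> (\<forall>K'\<in>S. K' \<subseteq> K) \<longrightarrow>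
      (\<forall>e>0. \<exists>F. finite F \<and> F \<subseteq> S \<and> l K - l (\<Union>F) < e) \<longrightarrow> K \<in> J"
    using assms(1) unfolding content_ideal_def by (elim conjE)
  from this[rule_format, of K S] show ?thesis
    using assms(2-) by simp
qed

lemma ideal_null: "content_ideal X l J \<Longrightarrow> compactin X K \<Longrightarrow> l K = 0 \<Longrightarrow> K \<in> J"
  by (rule ideal_exhaust[of _ _ "{}"]) (auto simp: content_empty)

lemma ideal_finite_Union:
  "content_ideal X l J \<Longrightarrow> compactin X (\<Union>F) \<Longrightarrow> finite F \<Longrightarrow> F \<subseteq> J \<Longrightarrow> \<Union>F \<in> J"
  by (rule ideal_exhaust[of _ _ F]) (simp_all, blast, metis diff_self order_refl)

lemma ideal_compacts: "content_ideal X l {K. compactin X K}"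
  by (rule content_idealI) simp_all

lemma ideal_Inter:
  assumes "\<And>J. J \<in> A \<Longrightarrow> content_ideal X l J" "A \<noteq> {}"
  shows "content_ideal X l (\<Inter>A)"
proof (rule content_idealI)
  show "compactin X K" if "K \<in> \<Inter>A" for K
    using assms ideal_compactin that by blast
  show "K' \<in> \<Inter>A" if "K \<in> \<Inter>A" "compactin X K'" "K' \<subseteq> K" for K K'
    using assms(1) ideal_down that by blast
  fix K S assume *: "compactin X K" "S \<subseteq> \<Inter>A" "\<And>K'. K' \<in> S \<Longrightarrow> K' \<subseteq> K"
    "\<And>e. 0 < e \<Longrightarrow> \<exists>F. finite F \<and> F \<subseteq> S \<and> l K - l (\<Union>F) < e"
  have "K \<in> J" if J: "J \<in> A" for J
  proof (rule ideal_exhaust[OF assms(1)[OF J] *(1) _ *(3,4)])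
    show "S \<subseteq> J"
      using *(2) J by blast
  qed
  then show "K \<in> \<Inter>A"
    by blast
qed

lemma ideal_generated: "A \<subseteq> {K. compactin X K} \<Longrightarrow> content_ideal X l (generated A)"
  unfolding hull_def using ideal_compacts by (intro ideal_Inter) auto

text \<open>The Heyting implication from \<open>A\<close> to \<open>J\<close>. An exhaustion of \<open>K\<close> restricts to one of any \<open>C \<subseteq> K\<close>
  in \<open>A\<close>, by the sets \<open>C \<inter> K'\<close>, which lie in \<open>A\<close> again and hence in \<open>J\<close>.\<close>

lemma ideal_residual:
  assumes "down_closed A" "content_ideal X l J"
  shows "content_ideal X l {K. compactin X K \<and> (\<forall>C\<in>A. C \<subseteq> K \<longrightarrow> C \<in> J)}" (is "content_ideal X l ?R")
proof (rule content_idealI)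
  show "compactin X K" if "K \<in> ?R" for K
    using that by simp
  show "K' \<in> ?R" if "K \<in> ?R" "compactin X K'" "K' \<subseteq> K" for K K'
    using that by auto
  fix K S assume K: "compactin X K" and S: "S \<subseteq> ?R" "\<And>K'. K' \<in> S \<Longrightarrow> K' \<subseteq> K"
    and approx: "\<And>e. 0 < e \<Longrightarrow> \<exists>F. finite F \<and> F \<subseteq> S \<and> l K - l (\<Union>F) < e"
  have "C \<in> J" if C: "C \<in> A" "C \<subseteq> K" for C
  proof (rule ideal_exhaust[OF assms(2), of _ "(\<inter>) C ` S"])
    show compC: "compactin X C"
      using assms(1) C by (auto simp: down_closed_def)
    have "C \<inter> K' \<in> J" if "K' \<in> S" for K'
    proof -
      have "compactin X (C \<inter> K')"
        using compC S(1) that by (auto intro: compactin_Int)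
      then have "C \<inter> K' \<in> A"
        using assms(1) C unfolding down_closed_def by blast
      then show ?thesis
        using S(1) that by auto
    qed
    then show "(\<inter>) C ` S \<subseteq> J"
      by auto
    fix e :: real assume "0 < e"
    then obtain F where F: "finite F" "F \<subseteq> S" "l K - l (\<Union>F) < e"
      using approx by blast
    have "compactin X (\<Union>F)"
      using F S(1) by (intro compactin_Union) auto
    then have "l C - l (C \<inter> \<Union>F) \<le> l K - l (\<Union>F)"
      by (intro content_deficit_Int_le K compC C(2) Union_least S(2)) (use F(2) in auto)
    moreover have "\<Union>((\<inter>) C ` F) = C \<inter> \<Union>F"
      by blast
    ultimately have "l C - l (\<Union>((\<inter>) C ` F)) < e"
      using F(3) by (metis le_less_trans)
    then show "\<exists>F'. finite F' \<and> F' \<subseteq> (\<inter>) C ` S \<and> l C - l (\<Union>F') < e"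
      using F(1,2) by (meson finite_imageI image_mono)
  qed blast
  with K show "K \<in> ?R"
    by simp
qed

text \<open>The hypothesis says that \<open>A\<close> is contained in the implication from \<open>B\<close> to \<open>J\<close>; as the latter is
  an ideal, it contains the ideal generated by \<open>A\<close> too.\<close>

lemma generated_Int_subset:
  assumes "down_closed B" "content_ideal X l J" "A \<subseteq> {K. compactin X K}"
    and "\<And>C K. K \<in> A \<Longrightarrow> C \<in> B \<Longrightarrow> C \<subseteq> K \<Longrightarrow> C \<in> J"
  shows "generated A \<inter> B \<subseteq> J"
proof -
  let ?R = "{K. compactin X K \<and> (\<forall>C\<in>B. C \<subseteq> K \<longrightarrow> C \<in> J)}"
  have "A \<subseteq> ?R"
    using assms(3,4) by blast
  then have "generated A \<subseteq> ?R"
    by (rule hull_minimal) (rule ideal_residual[OF assms(1,2)])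
  then show ?thesis
    by blast
qed

text \<open>The preceding lemma is applied twice: it replaces first \<open>A\<close> and then \<open>B\<close> by the generated
  ideal.\<close>

lemma generated_Int:
  assumes A: "down_closed A" and B: "down_closed B"
  shows "generated A \<inter> generated B = generated (A \<inter> B)"
proof
  have compact: "A \<subseteq> {K. compactin X K}" "B \<subseteq> {K. compactin X K}"
    using assms by (auto simp: down_closed_def)
  then have J: "content_ideal X l (generated (A \<inter> B))"
    by (intro ideal_generated) blast
  have gen_A: "content_ideal X l (generated A)"
    by (rule ideal_generated[OF compact(1)])
  have "C \<in> A" if "K \<in> A" "C \<in> B" "C \<subseteq> K" for C K
    using A compact(2) that unfolding down_closed_def by blast
  then have step: "generated A \<inter> B \<subseteq> generated (A \<inter> B)"
    by (intro generated_Int_subset[OF B J compact(1)] hull_inc) blast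
  have "generated B \<inter> generated A \<subseteq> generated (A \<inter> B)"
  proof (rule generated_Int_subset[OF down_closed_ideal[OF gen_A] J compact(2)])
    fix C K assume "K \<in> B" "C \<in> generated A" "C \<subseteq> K"
    moreover from this have "C \<in> B"
      using B ideal_compactin[OF gen_A] unfolding down_closed_def by blast
    ultimately show "C \<in> generated (A \<inter> B)"
      using step by blast
  qed
  then show "generated A \<inter> generated B \<subseteq> generated (A \<inter> B)"
    by blast
  show "generated (A \<inter> B) \<subseteq> generated A \<inter> generated B"
    by (simp add: hull_mono)
qed

lemma frame_of_sets_ideals: "frame_of_sets {J. content_ideal X l J} (\<lambda>A. generated (\<Union>A))"
proof
  fix A :: "'a set set set" assume A: "A \<subseteq> {J. content_ideal X l J}"
  then have compact: "\<Union>A \<subseteq> {K. compactin X K}"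
    using ideal_compactin by blast
  show "generated (\<Union>A) \<in> {J. content_ideal X l J}"
    using ideal_generated[OF compact] by simp
  show "U \<subseteq> generated (\<Union>A)" if "U \<in> A" for U
    using that hull_subset[of "\<Union>A"] by blast
  show "generated (\<Union>A) \<subseteq> V" if "V \<in> {J. content_ideal X l J}" "\<And>U. U \<in> A \<Longrightarrow> U \<subseteq> V" for V
    using that by (intro hull_minimal Union_least) simp_all
  show "V \<inter> generated (\<Union>A) \<subseteq> generated (\<Union> ((\<inter>) V ` A))" if "V \<in> {J. content_ideal X l J}" for V
  proof -
    have "V \<inter> generated (\<Union>A) = generated V \<inter> generated (\<Union>A)"
      using that by (simp add: hull_same)
    also have "\<dots> = generated (V \<inter> \<Union>A)"
      using A that by (intro generated_Int down_closed_Union down_closed_ideal) blast+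
    also have "V \<inter> \<Union>A = \<Union> ((\<inter>) V ` A)"
      by blast
    finally show ?thesis
      by simp
  qed
next
  fix U V assume "U \<in> {J. content_ideal X l J}" "V \<in> {J. content_ideal X l J}"
  then have "content_ideal X l (\<Inter>{U, V})"
    by (intro ideal_Inter) auto
  then show "U \<inter> V \<in> {J. content_ideal X l J}"
    by simp
qed

sublocale ideals: frame_of_sets "{J. content_ideal X l J}" "\<lambda>A. generated (\<Union>A)"
  rewrites "\<lparr>carrier = {J. content_ideal X l J}, eq = (=), le = (\<subseteq>)\<rparr> = measure_locale X l"
  by (simp_all add: frame_of_sets_ideals measure_locale_def)

lemma top_ideal: "generated (\<Union>{J. content_ideal X l J}) = {K. compactin X K}"
proof -
  have "\<Union>{J. content_ideal X l J} = {K. compactin X K}"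
    using ideal_compacts ideal_compactin by blast
  then show ?thesis
    by (simp add: hull_same ideal_compacts)
qed

lemma measure_proj_open: "openin X V \<Longrightarrow> measure_proj X l V = generated {K. compactin X K \<and> K \<subseteq> V}"
  by (simp add: measure_proj_def carrier_open_locale)

lemma ideal_measure_proj: "openin X V \<Longrightarrow> content_ideal X l (measure_proj X l V)"
  unfolding measure_proj_open by (rule ideal_generated) blast

text \<open>By local compactness, a compact set covered by opens \<open>V\<close> is a finite union of compact sets, each
  contained in one \<open>V\<close>. This gives the preservation of joins by \<open>measure_proj\<close>.\<close>

lemma compact_subset_Union_in_ideal:
  assumes J: "content_ideal X l J"
    and A: "\<And>V. V \<in> A \<Longrightarrow> openin X V" "\<And>V K. V \<in> A \<Longrightarrow> compactin X K \<Longrightarrow> K \<subseteq> V \<Longrightarrow> K \<in> J"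
    and K: "compactin X K" "K \<subseteq> \<Union>A"
  shows "K \<in> J"
proof -
  \<comment> \<open>The opens that are small enough to lie in a compact subset of one member of \<open>A\<close>.\<close>
  define \<U> where "\<U> = {U. openin X U \<and> (\<exists>N. compactin X N \<and> U \<subseteq> N \<and> (\<exists>V\<in>A. N \<subseteq> V))}"
  have nbhd: "neighbourhood_base_of (compactin X) X"
    using locally_compact Hausdorff by (simp add: locally_compact_space_neighbourhood_base)
  have "K \<subseteq> \<Union>\<U>"
  proof
    fix x assume "x \<in> K"
    then obtain V where V: "x \<in> V" "V \<in> A"
      using K by auto
    have "\<exists>U N. openin X U \<and> compactin X N \<and> x \<in> U \<and> U \<subseteq> N \<and> N \<subseteq> V"
      using nbhd V(1) A(1)[OF V(2)] unfolding neighbourhood_base_of by simp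
    then show "x \<in> \<Union>\<U>"
      using V(2) unfolding \<U>_def by blast
  qed
  moreover have "openin X U" if "U \<in> \<U>" for U
    using that by (simp add: \<U>_def)
  ultimately obtain \<F> where F: "finite \<F>" "\<F> \<subseteq> \<U>" "K \<subseteq> \<Union>\<F>"
    using compactinD[OF K(1), of \<U>] by metis
  from F(2) have "\<forall>U\<in>\<F>. \<exists>N. compactin X N \<and> U \<subseteq> N \<and> (\<exists>V\<in>A. N \<subseteq> V)"
    unfolding \<U>_def by blast
  from bchoice[OF this] obtain N
    where N: "\<forall>U\<in>\<F>. compactin X (N U) \<and> U \<subseteq> N U \<and> (\<exists>V\<in>A. N U \<subseteq> V)"
    by blast
  have eq: "K = \<Union>((\<lambda>U. K \<inter> N U) ` \<F>)"
  proof
    show "K \<subseteq> \<Union>((\<lambda>U. K \<inter> N U) ` \<F>)"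
    proof
      fix x assume "x \<in> K"
      then obtain U where "U \<in> \<F>" "x \<in> U"
        using F(3) by blast
      then show "x \<in> \<Union>((\<lambda>U. K \<inter> N U) ` \<F>)"
        using N \<open>x \<in> K\<close> by blast
    qed
  qed (intro UN_least Int_lower1)
  have "K \<inter> N U \<in> J" if U: "U \<in> \<F>" for U
  proof -
    obtain V where V: "compactin X (N U)" "V \<in> A" "N U \<subseteq> V"
      using bspec[OF N U] by blast
    show ?thesis
      by (rule A(2)[OF V(2) compactin_Int[OF K(1) V(1)]]) (use V(3) in blast)
  qed
  moreover have "compactin X (\<Union>((\<lambda>U. K \<inter> N U) ` \<F>))"
    using K(1) by (simp only: eq[symmetric])
  ultimately have "\<Union>((\<lambda>U. K \<inter> N U) ` \<F>) \<in> J"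
    using F(1) by (intro ideal_finite_Union J finite_imageI image_subsetI)
  then show ?thesis
    by (simp only: eq[symmetric])
qed

lemma continuous_measure_proj:
  "measure_proj X l \<in> continuous_locale_maps (measure_locale X l) (open_locale X)"
proof -
  have sup: "measure_proj X l (\<Union>A) = generated (\<Union>(measure_proj X l ` A))"
    if A: "A \<subseteq> {V. openin X V}" for A
  proof
    let ?J = "generated (\<Union>(measure_proj X l ` A))"
    have J: "content_ideal X l ?J"
      using A ideal_measure_proj ideal_compactin by (intro ideal_generated) blast
    have inJ: "K \<in> ?J" if "V \<in> A" "compactin X K" "K \<subseteq> V" for V K
    proof -
      have "openin X V"
        using A that(1) by blast
      then have "K \<in> measure_proj X l V"
        unfolding measure_proj_open[OF \<open>openin X V\<close>] by (intro hull_inc) (simp add: that)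
      then show ?thesis
        using that by (intro hull_inc) blast
    qed
    have UA: "openin X (\<Union>A)"
      using A by blast
    have "K \<in> ?J" if "compactin X K" "K \<subseteq> \<Union>A" for K
    proof (rule compact_subset_Union_in_ideal[OF J _ inJ that])
      show "openin X V" if "V \<in> A" for V
        using A that by blast
    qed
    then show "measure_proj X l (\<Union>A) \<subseteq> ?J"
      unfolding measure_proj_open[OF UA] by (intro hull_minimal J) blast
    have "measure_proj X l V \<subseteq> measure_proj X l (\<Union>A)" if "V \<in> A" for V
    proof -
      have "openin X V"
        using A that by blast
      then show ?thesis
        unfolding measure_proj_open[OF \<open>openin X V\<close>] measure_proj_open[OF UA]
        by (intro hull_mono) (use that in blast)
    qed
    then show "?J \<subseteq> measure_proj X l (\<Union>A)"
      by (intro hull_minimal ideal_measure_proj UA) blast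
  qed
  have meet: "measure_proj X l (U \<inter> V) = measure_proj X l U \<inter> measure_proj X l V"
    if "openin X U" "openin X V" for U V
  proof -
    have "{K. compactin X K \<and> K \<subseteq> U \<inter> V} = {K. compactin X K \<and> K \<subseteq> U} \<inter> {K. compactin X K \<and> K \<subseteq> V}"
      by auto
    then show ?thesis
      using that by (simp add: measure_proj_open generated_Int down_closed_open openin_Int)
  qed
  have top: "measure_proj X l (\<Union>{U. openin X U}) = {K. compactin X K}"
  proof -
    have "\<Union>{U. openin X U} = topspace X"
      using openin_subset by blast
    moreover have "{K. compactin X K \<and> K \<subseteq> topspace X} = {K. compactin X K}"
      by (auto dest: compactin_subset_topspace)
    ultimately show ?thesis
      by (simp add: measure_proj_open hull_same ideal_compacts)
  qed
  have carrier: "carrier (measure_locale X l) = {J. content_ideal X l J}"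
    by (simp add: measure_locale_def)
  show ?thesis
    unfolding continuous_locale_maps_def frame_homs_def
  proof (intro CollectI conjI allI impI ballI)
    show "measure_proj X l \<in> carrier (open_locale X) \<rightarrow>\<^sub>E carrier (measure_locale X l)"
      unfolding carrier carrier_open_locale
      by (intro PiE_I) (simp_all add: ideal_measure_proj, simp add: measure_proj_def carrier_open_locale)
    show "measure_proj X l \<top>\<^bsub>open_locale X\<^esub> = \<top>\<^bsub>measure_locale X l\<^esub>"
      unfolding open_locale_top ideals.top_eq top_ideal by (rule top)
    show "measure_proj X l (\<Squnion>\<^bsub>open_locale X\<^esub>A) = \<Squnion>\<^bsub>measure_locale X l\<^esub>(measure_proj X l ` A)"
      if "A \<subseteq> carrier (open_locale X)" for A
    proof -
      have A: "A \<subseteq> {V. openin X V}"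
        using that by (simp add: carrier_open_locale)
      moreover have "measure_proj X l ` A \<subseteq> {J. content_ideal X l J}"
        using A ideal_measure_proj by blast
      ultimately show ?thesis
        using sup by (simp add: open_locale_Sup ideals.Sup_eq)
    qed
    show "measure_proj X l (U \<sqinter>\<^bsub>open_locale X\<^esub> V) = measure_proj X l U \<sqinter>\<^bsub>measure_locale X l\<^esub> measure_proj X l V"
      if "U \<in> carrier (open_locale X)" "V \<in> carrier (open_locale X)" for U V
      using that meet by (simp add: carrier_open_locale open_locale_meet ideals.meet_eq ideal_measure_proj)
  qed (rule open_locale_frame ideals.frame)+
qed

section \<open>Points of positive content\<close>

text \<open>The inverse image of the point of the measure locale carried by \<open>x\<close>. It is a point only if
  \<open>{x}\<close> has positive content, since otherwise even the smallest ideal contains \<open>{x}\<close>.\<close>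

definition atom_point :: "'a \<Rightarrow> 'a set set \<Rightarrow> unit set" where
  "atom_point x = (\<lambda>J\<in>{J. content_ideal X l J}. if {x} \<in> J then UNIV else {})"

text \<open>Compact sets \<open>K' \<subseteq> K\<close> that miss a point \<open>x\<close> of \<open>K\<close> leave a defect of at least the content of
  \<open>{x}\<close>, so they cannot exhaust \<open>K\<close>.\<close>

lemma ideal_avoiding:
  assumes x: "x \<in> topspace X" "0 < l {x}"
  shows "content_ideal X l {K. compactin X K \<and> x \<notin> K}" (is "content_ideal X l ?P")
proof (rule content_idealI)
  fix K S assume K: "compactin X K" and S: "S \<subseteq> ?P" "\<And>K'. K' \<in> S \<Longrightarrow> K' \<subseteq> K"
    and approx: "\<And>e. 0 < e \<Longrightarrow> \<exists>F. finite F \<and> F \<subseteq> S \<and> l K - l (\<Union>F) < e"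
  have "x \<notin> K"
  proof
    assume "x \<in> K"
    obtain F where F: "finite F" "F \<subseteq> S" "l K - l (\<Union>F) < l {x}"
      using approx x(2) by blast
    have comp: "compactin X (\<Union>F)"
      using F S(1) by (intro compactin_Union) auto
    then have "l ({x} \<union> \<Union>F) = l {x} + l (\<Union>F)"
      using F S(1) x(1) by (intro content_Un_disjoint) auto
    moreover have "l ({x} \<union> \<Union>F) \<le> l K"
      using F S(2) comp x(1) \<open>x \<in> K\<close> by (intro content_mono compactin_Un K) auto
    ultimately show False
      using F(3) by linarith
  qed
  then show "K \<in> ?P"
    using K by simp
qed auto

text \<open>Generating an ideal does not create the atom \<open>{x}\<close>: a downward closed family without it consists
  of sets missing \<open>x\<close>, and these form an ideal.\<close>

lemma singleton_in_generated_iff: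
  assumes x: "x \<in> topspace X" "0 < l {x}" and A: "down_closed A"
  shows "{x} \<in> generated A \<longleftrightarrow> {x} \<in> A"
proof
  assume *: "{x} \<in> generated A"
  show "{x} \<in> A"
  proof (rule ccontr)
    assume "{x} \<notin> A"
    then have "A \<subseteq> {K. compactin X K \<and> x \<notin> K}"
      using A x(1) by (auto simp: down_closed_def)
    then have "generated A \<subseteq> {K. compactin X K \<and> x \<notin> K}"
      using ideal_avoiding[OF x] by (intro hull_minimal) auto
    with * show False
      by auto
  qed
qed (rule hull_inc)

lemma atom_point_in_pts:
  assumes x: "x \<in> topspace X" "0 < l {x}"
  shows "atom_point x \<in> pts (measure_locale X l)"
  unfolding ideals.mem_pts_iff
proof (intro conjI allI impI ballI)
  show "atom_point x (generated (\<Union>{J. content_ideal X l J})) = UNIV"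
    using x by (simp add: top_ideal atom_point_def ideal_compacts)
  fix A assume A: "A \<subseteq> {J. content_ideal X l J}"
  have "down_closed (\<Union>A)"
    using A by (intro down_closed_Union) (auto intro: down_closed_ideal)
  then show "atom_point x (generated (\<Union>A)) = \<Union>(atom_point x ` A)"
    using A ideals.lub_mem[OF A] by (auto simp: atom_point_def singleton_in_generated_iff x subset_eq)
next
  fix U V assume "U \<in> {J. content_ideal X l J}" "V \<in> {J. content_ideal X l J}"
  then show "atom_point x (U \<inter> V) = atom_point x U \<inter> atom_point x V"
    using ideals.Int_mem[of U V] by (auto simp: atom_point_def)
qed (simp add: atom_point_def)

lemma pts_map_atom_point:
  assumes x: "x \<in> topspace X" "0 < l {x}"
  shows "pts_map (open_locale X) (measure_proj X l) (atom_point x) = space_point X x"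
proof (rule extensionalityI[of _ "{V. openin X V}"])
  fix V assume V: "V \<in> {V. openin X V}"
  then have "content_ideal X l (measure_proj X l V)"
    by (simp add: ideal_measure_proj)
  then show "pts_map (open_locale X) (measure_proj X l) (atom_point x) V = space_point X x V"
    using V x by (simp add: pts_map_def locale_comp_def carrier_open_locale compose_eq atom_point_def
        space_point_eq measure_proj_open singleton_in_generated_iff down_closed_open)
qed (simp_all add: pts_map_def locale_comp_def carrier_open_locale space_point_eq)

text \<open>A compact set \<open>K\<close> containing \<open>x\<close> is exhausted by the sets \<open>(K - U) \<union> {x}\<close>, where \<open>U\<close> runs through the
  small neighbourhoods of \<open>x\<close>.\<close>

lemma ideal_containing_atom_eq_top:
  assumes J: "content_ideal X l J" and x: "{x} \<in> J"
    and avoid: "\<And>K. compactin X K \<Longrightarrow> x \<notin> K \<Longrightarrow> K \<in> J"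
    and K: "compactin X K"
  shows "K \<in> J"
proof (cases "x \<in> K")
  case True
  have cx: "compactin X {x}"
    using J x by (auto simp: content_ideal_def)
  show ?thesis
  proof (rule ideal_exhaust[OF J K, of "{K' \<in> J. K' \<subseteq> K}"])
    fix e :: real assume "0 < e"
    then obtain U N where UN: "openin X U" "compactin X N" "{x} \<subseteq> U" "U \<subseteq> N" "l N < l {x} + e"
      using compact_neighbourhood_approx[OF cx] by blast
    have KU: "compactin X (K - U)"
      using K UN by (simp add: compactin_Diff)
    have "l K \<le> l ((K - U) \<union> N)"
      using UN KU K by (intro content_mono) (auto simp: compactin_Un)
    also have "\<dots> \<le> l (K - U) + l N"
      using UN KU by (intro content_Un_le)
    finally have "l K < l (K - U) + l {x} + e"
      using UN by linarith
    moreover have "l ((K - U) \<union> {x}) = l (K - U) + l {x}"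
      using UN KU cx by (intro content_Un_disjoint) auto
    moreover have "K - U \<in> J"
      using UN KU by (intro avoid) auto
    ultimately show "\<exists>F. finite F \<and> F \<subseteq> {K' \<in> J. K' \<subseteq> K} \<and> l K - l (\<Union>F) < e"
      using x True by (intro exI[of _ "{K - U, {x}}"]) auto
  qed auto
qed (use avoid K in auto)

text \<open>Let \<open>W\<close> be the largest ideal killed by \<open>p\<close>. It contains all compact sets missing \<open>x\<close> because \<open>p\<close>
  lies over \<open>x\<close>, but not \<open>{x}\<close>, as it would then be everything. This leaves only one possible \<open>W\<close>.\<close>

lemma point_over_space_point:
  assumes p: "p \<in> pts (measure_locale X l)" and x: "x \<in> topspace X"
    and over: "pts_map (open_locale X) (measure_proj X l) p = space_point X x"
  shows "0 < l {x}" "p = atom_point x"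
proof -
  obtain W where kernel: "W \<in> {J. content_ideal X l J}" "\<not> generated (\<Union>{J. content_ideal X l J}) \<subseteq> W"
    "\<And>J. J \<in> {J. content_ideal X l J} \<Longrightarrow> p J = (if J \<subseteq> W then {} else UNIV)"
    by (rule ideals.point_kernel[OF p]) (rule that)
  have W: "content_ideal X l W" "\<not> {K. compactin X K} \<subseteq> W"
    using kernel(1) kernel(2)[unfolded top_ideal] by simp_all
  have pW: "p J = (if J \<subseteq> W then {} else UNIV)" if "content_ideal X l J" for J
    using kernel(3)[of J] that by simp
  have ext: "p \<in> extensional {J. content_ideal X l J}"
    using p by (simp add: ideals.mem_pts_iff)
  define V where "V = topspace X - {x}"
  have V: "openin X V"
    unfolding V_def by (intro openin_diff openin_topspace closedin_Hausdorff_singleton Hausdorff x)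
  have "p (measure_proj X l V) = space_point X x V"
    using over[symmetric] V by (simp add: pts_map_def locale_comp_def carrier_open_locale compose_eq)
  then have "p (measure_proj X l V) = {}"
    using V by (simp add: space_point_eq V_def)
  moreover have "content_ideal X l (measure_proj X l V)"
    using V by (rule ideal_measure_proj)
  ultimately have proj_le: "measure_proj X l V \<subseteq> W"
    using pW[of "measure_proj X l V"] by (simp split: if_splits)
  have avoid: "K \<in> W" if K: "compactin X K" "x \<notin> K" for K
  proof -
    have "K \<subseteq> V"
      using compactin_subset_topspace[OF K(1)] K(2) by (auto simp: V_def)
    then have "K \<in> measure_proj X l V"
      unfolding measure_proj_open[OF V] using K(1) by (intro hull_inc) simp
    then show ?thesis
      using proj_le by blast
  qed
  have notin: "{x} \<notin> W"
    using ideal_containing_atom_eq_top[OF W(1) _ avoid] W(2) by blast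
  moreover have "{x} \<in> W" if "l {x} = 0"
    using x that by (intro ideal_null[OF W(1)]) simp_all
  ultimately have "l {x} \<noteq> 0"
    by blast
  then show "0 < l {x}"
    using content_nonneg[of "{x}"] x by simp
  have "J \<subseteq> W \<longleftrightarrow> {x} \<notin> J" if J: "content_ideal X l J" for J
  proof
    assume nx: "{x} \<notin> J"
    show "J \<subseteq> W"
    proof
      fix K assume K: "K \<in> J"
      have "x \<notin> K"
        using nx x ideal_down[OF J K, of "{x}"] by auto
      with ideal_compactin[OF J K] show "K \<in> W"
        by (rule avoid)
    qed
  qed (use notin in blast)
  then have eq: "p J = atom_point x J" if "J \<in> {J. content_ideal X l J}" for J
    using that by (simp add: atom_point_def pW)
  have "atom_point x \<in> extensional {J. content_ideal X l J}"
    by (simp add: atom_point_def)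
  then show "p = atom_point x"
    by (rule extensionalityI[OF ext _ eq])
qed

end

theorem proposition1p14:
  fixes X :: "'a topology" and l :: "'a set \<Rightarrow> real"
  assumes "Hausdorff_space X"
    and "regular_content X l"
  shows "pts_map (open_locale X) (measure_proj X l)
           \<in> pts (measure_locale X l) \<rightarrow> pts (open_locale X)
       \<and> inj_on (pts_map (open_locale X) (measure_proj X l)) (pts (measure_locale X l))
       \<and> pts_map (open_locale X) (measure_proj X l) ` pts (measure_locale X l)
           = space_point X ` {x \<in> topspace X. l {x} > 0}"
proof -
  interpret regular_content_space X l
    using assms by unfold_locales
  let ?f = "pts_map (open_locale X) (measure_proj X l)"
  have maps: "?f \<in> pts (measure_locale X l) \<rightarrow> pts (open_locale X)"
    using pts_map_in_pts[OF continuous_measure_proj] by blast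
  have classify: "\<exists>x\<in>topspace X. 0 < l {x} \<and> ?f p = space_point X x"
    if p: "p \<in> pts (measure_locale X l)" for p
    by (metis Hausdorff_imp_sober[OF assms(1)] funcset_mem[OF maps p] point_over_space_point(1) p)
  have "inj_on ?f (pts (measure_locale X l))"
  proof (rule inj_onI)
    fix p p' assume p: "p \<in> pts (measure_locale X l)" "p' \<in> pts (measure_locale X l)" "?f p = ?f p'"
    obtain x where "x \<in> topspace X" "?f p = space_point X x"
      using classify[OF p(1)] by blast
    then show "p = p'"
      using p point_over_space_point(2) by metis
  qed
  moreover have "?f ` pts (measure_locale X l) = space_point X ` {x \<in> topspace X. l {x} > 0}"
  proof
    show "?f ` pts (measure_locale X l) \<subseteq> space_point X ` {x \<in> topspace X. l {x} > 0}"
      using classify by blast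
    show "space_point X ` {x \<in> topspace X. l {x} > 0} \<subseteq> ?f ` pts (measure_locale X l)"
      using atom_point_in_pts by (auto simp flip: pts_map_atom_point)
  qed
  ultimately show ?thesis
    using maps by blast
qed

end
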